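(* Let $\alpha,\beta>0$ be hyperparameters, $N\ge1$ an integer, and let $\hat{\mathbf{y}},\tilde{\mathbf{y}}\in\mathbb{R}^N$ be the network logit and the pseudo logit of one example in D2, with prediction $\hat{\mathbf{p}}=\sigma(\hat{\mathbf{y}})$ and pseudo-label $\tilde{\mathbf{p}}=\sigma(\tilde{\mathbf{y}})$. Let $\mathcal{L}=\alpha\mathcal{L}_c+\beta\mathcal{L}_e$ be the loss of this example, and let $n\in\{1,\dots,N\}$ be such that $\hat p_n$ is the largest value among $\hat p_1,\dots,\hat p_N$. If $$\tilde p_n=\exp\!\left(-\frac{\mathcal{L}}{\alpha}\right)\left(\hat p_n\right)^{1-\frac{\beta}{\alpha}},$$ then $\tilde p_n\le\hat p_n$.
   Context: $\sigma:\mathbb{R}^N\to\mathbb{R}^N$ is the softmax function, $\sigma(\mathbf{y})_i=\exp(y_i)/\sum_{j=1}^N\exp(y_j)$. In the D2 (deep decipher) framework, each example has a network prediction $\hat{\mathbf{p}}=\sigma(\hat{\mathbf{y}})$ and a pseudo-label $\tilde{\mathbf{p}}=\sigma(\tilde{\mathbf{y}})$, where the pseudo logit $\tilde{\mathbf{y}}$ is a free variable, and the loss of the example is $\mathcal{L}=\alpha\mathcal{L}_c+\beta\mathcal{L}_e$ with $$\mathcal{L}_c=\sum_{j=1}^N\hat p_j\left[\log\hat p_j-\log\tilde p_j\right],\qquad \mathcal{L}_e=-\sum_{j=1}^N\hat p_j\log\hat p_j .$$ *)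

theory Defs
  imports "HOL-Analysis.Analysis"
begin

definition softmax :: "real ^ 'N \<Rightarrow> real ^ 'N" where
  "softmax y = (\<chi> i. exp (y $ i) / (\<Sum>j\<in>UNIV. exp (y $ j)))"

text \<open>
  In the losses below, \<open>p\<close> is the network prediction and \<open>q\<close> the pseudo-label. The logarithms
  are natural; both arguments are meant to be values of \<^const>\<open>softmax\<close>, so that all their entries
  are positive.
\<close>

definition classification_loss :: "real ^ 'N \<Rightarrow> real ^ 'N \<Rightarrow> real" where
  "classification_loss p q = (\<Sum>j\<in>UNIV. p $ j * (ln (p $ j) - ln (q $ j)))"

definition entropy_loss :: "real ^ 'N \<Rightarrow> real" where
  "entropy_loss p = - (\<Sum>j\<in>UNIV. p $ j * ln (p $ j))"

definition D2_loss :: "real \<Rightarrow> real \<Rightarrow> real ^ 'N \<Rightarrow> real ^ 'N \<Rightarrow> real" where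
  "D2_loss \<alpha> \<beta> p q = \<alpha> * classification_loss p q + \<beta> * entropy_loss p"

end

(* Gibbs' inequality gives L >= beta * H(p_hat), and H(p_hat) >= - ln (p_hat_n) because p_hat_n is
   the largest entry. Substituting both into the logarithm of the assumed identity, the two terms
   (beta/alpha) * ln (p_hat_n) cancel and ln (p_tilde_n) <= ln (p_hat_n) remains. *)
theory Submission
  imports Defs
begin

lemma softmax_pos: "softmax y $ i > 0"
  by (auto simp: softmax_def intro!: divide_pos_pos sum_pos)

lemma sum_softmax: "(\<Sum>i\<in>UNIV. softmax y $ i) = 1"
proof -
  have "(\<Sum>j\<in>UNIV. exp (y $ j)) > 0"
    by (intro sum_pos) auto
  then show ?thesis
    by (simp add: softmax_def flip: sum_divide_distrib)
qed

text \<open>Gibbs' inequality: \<open>ln x \<le> x - 1\<close> at the ratio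
  \<open>x = q $ j / p $ j\<close>, weighted by \<open>p $ j\<close>, bounds each summand of the
  loss below by \<open>p $ j - q $ j\<close>. By \<open>sum\<close>, these differences have a
  nonnegative total.\<close>

lemma classification_loss_nonneg:
  fixes p q :: "real ^ 'N"
  assumes p: "\<And>j. p $ j > 0" and q: "\<And>j. q $ j > 0"
    and sum: "(\<Sum>j\<in>UNIV. q $ j) \<le> (\<Sum>j\<in>UNIV. p $ j)"
  shows "classification_loss p q \<ge> 0"
proof -
  have "p $ j - q $ j \<le> p $ j * (ln (p $ j) - ln (q $ j))" for j
  proof -
    have "ln (q $ j / p $ j) \<le> q $ j / p $ j - 1"
      using p[of j] q[of j] by (intro ln_le_minus_one) simp
    then have "p $ j * (ln (q $ j) - ln (p $ j)) \<le> p $ j * (q $ j / p $ j - 1)"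
      using p[of j] q[of j] by (intro mult_left_mono) (simp_all add: ln_div)
    also have "\<dots> = q $ j - p $ j"
      using p[of j] by (simp add: field_simps)
    finally show ?thesis
      by (simp add: algebra_simps)
  qed
  then have "(\<Sum>j\<in>UNIV. p $ j - q $ j) \<le> classification_loss p q"
    unfolding classification_loss_def by (intro sum_mono)
  with sum show ?thesis
    by (simp add: sum_subtractf)
qed

text \<open>The entropy is the mean of \<open>- ln (p $ j)\<close> under the weights
  \<open>p $ j\<close>. A mean is at least the smallest value averaged, which occurs at the largest
  entry because \<open>ln\<close> is increasing.\<close>

lemma entropy_loss_ge:
  fixes p :: "real ^ 'N"
  assumes p: "\<And>j. p $ j > 0" and sum: "(\<Sum>j\<in>UNIV. p $ j) = 1"
    and max: "\<And>j. p $ j \<le> p $ n"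
  shows "entropy_loss p \<ge> - ln (p $ n)"
proof -
  have "(\<Sum>j\<in>UNIV. p $ j * ln (p $ j)) \<le> (\<Sum>j\<in>UNIV. p $ j * ln (p $ n))"
    using p max by (intro sum_mono mult_left_mono) (auto simp: less_imp_le)
  also have "\<dots> = ln (p $ n)"
    using sum by (simp flip: sum_distrib_right)
  finally show ?thesis
    by (simp add: entropy_loss_def)
qed

theorem theorem2:
  fixes \<alpha> \<beta> L :: real
    and y_hat y_tilde p_hat p_tilde :: "real ^ 'N"
    and n :: 'N
  assumes "\<alpha> > 0" and "\<beta> > 0"
    and "p_hat = softmax y_hat" and "p_tilde = softmax y_tilde"
    and "L = D2_loss \<alpha> \<beta> p_hat p_tilde"
    and "\<And>j. p_hat $ j \<le> p_hat $ n"
    and "p_tilde $ n = exp (- L / \<alpha>) * (p_hat $ n) powr (1 - \<beta> / \<alpha>)"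
  shows "p_tilde $ n \<le> p_hat $ n"
proof -
  have pos: "p_hat $ j > 0" "p_tilde $ j > 0" for j
    using assms(3,4) by (simp_all add: softmax_pos)
  have sums: "(\<Sum>j\<in>UNIV. p_hat $ j) = 1" "(\<Sum>j\<in>UNIV. p_tilde $ j) = 1"
    using assms(3,4) by (simp_all add: sum_softmax)
  have "\<alpha> * classification_loss p_hat p_tilde \<ge> 0"
    using assms(1) pos sums by (simp add: classification_loss_nonneg)
  moreover have "\<beta> * entropy_loss p_hat \<ge> \<beta> * (- ln (p_hat $ n))"
    using assms(2,6) pos sums by (intro mult_left_mono entropy_loss_ge) auto
  ultimately have "L \<ge> - \<beta> * ln (p_hat $ n)"
    using assms(5) by (simp add: D2_loss_def)
  then have "- L / \<alpha> \<le> \<beta> / \<alpha> * ln (p_hat $ n)"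
    using assms(1) by (simp add: field_simps)
  \<comment> \<open>The same term is added to both sides, so the sign of
    \<open>1 - \<beta> / \<alpha>\<close> does not matter.\<close>
  then have "- L / \<alpha> + (1 - \<beta> / \<alpha>) * ln (p_hat $ n) \<le> ln (p_hat $ n)"
    by (simp add: algebra_simps)
  \<comment> \<open>A \<open>powr\<close> with base 0 is 0 by convention; positivity of
    \<open>p_hat $ n\<close> selects the branch \<open>exp (a * ln x)\<close>.\<close>
  moreover have "p_tilde $ n = exp (- L / \<alpha> + (1 - \<beta> / \<alpha>) * ln (p_hat $ n))"
    using assms(7) pos(1)[of n] by (simp only: exp_add) (simp add: powr_def)
  ultimately show ?thesis
    using pos(1)[of n] by (metis exp_le_cancel_iff exp_ln)
qed

end
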